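(* Let $X$ be an arbitrary nonempty set. Then $(F_{\mathcal{LLS}}(X);\circ)$ is the free left legal semigroup on the set $X$. That is, $(F_{\mathcal{LLS}}(X);\circ)$ is a left legal semigroup, it is generated by $X$ (each letter $x\in X$ being identified with the one-letter word $x$), and every mapping of $X$ into any left legal semigroup $A$ can be extended to a homomorphism of $(F_{\mathcal{LLS}}(X);\circ)$ into $A$.
   Context: A semigroup is a nonempty set with an associative multiplication. A semigroup is called left legal if it satisfies the identity $aba=ab$; $\mathcal{LLS}$ denotes the variety of all left legal semigroups. The elements of a nonempty set $X$ are called letters; a word is a finite sequence of letters from $X$. Let $F_{\mathcal{LLS}}(X)$ denote the set of all nonempty words over $X$ in which each letter $x\in X$ occurs at most once or twice, in the latter case in the form $xx$ at the beginning of the word (so the elements are exactly the words $z_1z_2\cdots z_k$ and $z_1z_1z_2\cdots z_k$ with $k\geq 1$ and $z_1,\dots,z_k$ pairwise distinct letters). For a word $\omega\in F_{\mathcal{LLS}}(X)$, let $\omega^*=\omega$ if the letters of $\omega$ are pairwise distinct, and otherwise let $\omega^*$ be the word obtained from $\omega$ by deleting one of its first two letters (which are equal to each other). For words $\omega_1,\omega_2$, let $\exists_{\omega_1}(\omega_2)$ denote the (possibly empty) word obtained from $\omega_2$ by removing all letters contained in $\omega_1$. The operation $\circ$ on $F_{\mathcal{LLS}}(X)$ is defined, for $\omega_1=x_1\dots x_n$ and $\omega_2=y_1\dots y_m$ in $F_{\mathcal{LLS}}(X)$, by $$\omega_1\circ\omega_2=\begin{cases} xx\,\exists_{\omega_1}(\omega_2^*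 ), & \text{if } \omega_1=x=y_1 \text{ for some } x\in X,\\ \omega_1\,\exists_{\omega_1}(\omega_2^* ), & \text{otherwise,}\end{cases}$$ where juxtaposition on the right-hand side is concatenation of words. (The condition $\omega_1=x=y_1$ means that $\omega_1$ is the one-letter word $x$ and the first letter of $\omega_2$ is $x$.) *)

theory Defs
  imports Main
begin

text \<open>Semigroups are given by a carrier set and a binary operation, whose values outside the
  carrier are irrelevant.\<close>

locale semigroup_on =
  fixes S :: "'a set" and f :: "'a \<Rightarrow> 'a \<Rightarrow> 'a"
  assumes nonempty: "S \<noteq> {}"
    and closed: "\<lbrakk>a \<in> S; b \<in> S\<rbrakk> \<Longrightarrow> f a b \<in> S"
    and assoc: "\<lbrakk>a \<in> S; b \<in> S; c \<in> S\<rbrakk> \<Longrightarrow> f (f a b) c = f a (f b c)"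

locale left_legal_semigroup = semigroup_on +
  assumes left_legal: "\<lbrakk>a \<in> S; b \<in> S\<rbrakk> \<Longrightarrow> f (f a b) a = f a b"

definition semigroup_hom ::
  "'a set \<Rightarrow> ('a \<Rightarrow> 'a \<Rightarrow> 'a) \<Rightarrow> 'b set \<Rightarrow> ('b \<Rightarrow> 'b \<Rightarrow> 'b) \<Rightarrow> ('a \<Rightarrow> 'b) \<Rightarrow> bool" where
  "semigroup_hom S f T g h \<longleftrightarrow>
     (\<forall>a\<in>S. h a \<in> T) \<and> (\<forall>a\<in>S. \<forall>b\<in>S. h (f a b) = g (h a) (h b))"

inductive_set generated :: "('a \<Rightarrow> 'a \<Rightarrow> 'a) \<Rightarrow> 'a set \<Rightarrow> 'a set"
  for f :: "'a \<Rightarrow> 'a \<Rightarrow> 'a" and G :: "'a set" where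
  base: "a \<in> G \<Longrightarrow> a \<in> generated f G"
| mult: "\<lbrakk>a \<in> generated f G; b \<in> generated f G\<rbrakk> \<Longrightarrow> f a b \<in> generated f G"

definition F_LLS :: "'a set \<Rightarrow> 'a list set" where
  "F_LLS X = {w. w \<noteq> [] \<and> set w \<subseteq> X \<and>
     (\<forall>x. count_list w x \<le> 2 \<and> (count_list w x = 2 \<longrightarrow> (\<exists>u. w = x # x # u)))}"

text \<open>If a word of \<open>F_LLS X\<close> is not distinct, its first two letters coincide, so deleting one of
  them amounts to taking the tail.\<close>

definition star :: "'a list \<Rightarrow> 'a list" where
  "star w = (if distinct w then w else tl w)"

definition remove_letters :: "'a list \<Rightarrow> 'a list \<Rightarrow> 'a list" where
  "remove_letters w1 w2 = filter (\<lambda>y. y \<notin> set w1) w2"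

definition lls_mult :: "'a list \<Rightarrow> 'a list \<Rightarrow> 'a list" where
  "lls_mult w1 w2 =
     (if \<exists>x u. w1 = [x] \<and> w2 = x # u
      then w1 @ w1 @ remove_letters w1 (star w2)
      else w1 @ remove_letters w1 (star w2))"

lemma distinct_count_list_le: "distinct zs \<Longrightarrow> count_list zs x \<le> 1"
  by (induction zs) auto

lemma F_LLS_eq:
  "F_LLS X = {zs. zs \<noteq> [] \<and> distinct zs \<and> set zs \<subseteq> X} \<union>
             {z # z # zs | z zs. distinct (z # zs) \<and> set (z # zs) \<subseteq> X}" (is "_ = ?R")
proof (intro set_eqI iffI)
  fix w assume w: "w \<in> F_LLS X"
  then have ne: "w \<noteq> []" and sub: "set w \<subseteq> X" and le: "\<And>y. count_list w y \<le> 2"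
    and two: "\<And>y. count_list w y = 2 \<Longrightarrow> \<exists>u. w = y # y # u"
    unfolding F_LLS_def by blast+
  show "w \<in> ?R"
  proof (cases "distinct w")
    case True
    with ne sub show ?thesis by blast
  next
    case False
    obtain xs y ys zs where dec: "w = xs @ [y] @ ys @ [y] @ zs"
      using not_distinct_decomp[OF False] by blast
    have "count_list w y = 2" using le[of y] unfolding dec by simp
    then obtain u where u: "w = y # y # u" using two by blast
    have ynu: "y \<notin> set u"
      using le[of y] unfolding u by (simp add: count_list_0_iff)
    have "distinct u"
    proof (rule ccontr)
      assume "\<not> distinct u"
      then obtain as v bs cs where d: "u = as @ [v] @ bs @ [v] @ cs"
        using not_distinct_decomp by blast
      have vy: "v \<noteq> y" using ynu unfolding d by auto
      have "count_list w v = 2" using le[of v] vy unfolding u d by simp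
      then obtain u' where "w = v # v # u'" using two by blast
      with u vy show False by simp
    qed
    with u ynu sub show ?thesis by auto
  qed
next
  fix w assume "w \<in> ?R"
  then show "w \<in> F_LLS X"
  proof (elim UnE)
    assume w: "w \<in> {zs. zs \<noteq> [] \<and> distinct zs \<and> set zs \<subseteq> X}"
    then have "count_list w x \<le> 2 \<and> count_list w x \<noteq> 2" for x
      using distinct_count_list_le[of w x] by simp
    with w show ?thesis unfolding F_LLS_def by blast
  next
    assume "w \<in> {z # z # zs | z zs. distinct (z # zs) \<and> set (z # zs) \<subseteq> X}"
    then obtain z zs where w: "w = z # z # zs"
      and dz: "z \<notin> set zs" "distinct zs" and sub: "set (z # zs) \<subseteq> X" by auto
    have "count_list w x \<le> 2 \<and> (count_list w x = 2 \<longrightarrow> (\<exists>u. w = x # x # u))" for x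
    proof (cases "x = z")
      case True
      with dz show ?thesis by (simp add: w)
    next
      case False
      with distinct_count_list_le[OF dz(2), of x] show ?thesis by (simp add: w)
    qed
    moreover have "w \<noteq> []" "set w \<subseteq> X" using w sub by simp_all
    ultimately show ?thesis unfolding F_LLS_def by blast
  qed
qed

end

theory Submission
  imports Defs
begin

text \<open>In a left legal semigroup \<open>abb = (aba)b = a(bab) = aba = ab\<close>. Hence a product of at least
  two factors absorbs each of its factors on the right, and an element that absorbs \<open>c\<close>
  continues to do so after being multiplied by anything on the right. Evaluating a word as a product
  is therefore insensitive to deleting repeated letters, except for the second letter of a word
  beginning with \<open>xx\<close>, and so evaluation is a homomorphism on \<open>F_LLS X\<close>. A word of \<open>F_LLS X\<close> is
  determined by its \<open>star\<close> and by whether it is distinct; associativity is checked on these two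
  invariants.\<close>

subsection \<open>Words\<close>

lemma F_LLS_cases:
  assumes "w \<in> F_LLS X"
  obtains (single) z zs where "w = z # zs" "distinct (z # zs)" "set (z # zs) \<subseteq> X"
    | (double) z zs where "w = z # z # zs" "distinct (z # zs)" "set (z # zs) \<subseteq> X"
proof -
  from assms consider "w \<noteq> []" "distinct w" "set w \<subseteq> X"
    | z zs where "w = z # z # zs" "distinct (z # zs)" "set (z # zs) \<subseteq> X"
    unfolding F_LLS_eq by blast
  then show thesis
  proof cases
    case 1
    then show thesis using single by (cases w) auto
  qed (fact double)
qed

lemma Cons_in_F_LLS: "distinct (z # zs) \<Longrightarrow> set (z # zs) \<subseteq> X \<Longrightarrow> z # zs \<in> F_LLS X"
  unfolding F_LLS_eq by blast

lemma Cons_Cons_in_F_LLS: "distinct (z # zs) \<Longrightarrow> set (z # zs) \<subseteq> X \<Longrightarrow> z # z # zs \<in> F_LLS X"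
  unfolding F_LLS_eq by blast

lemma star_distinct: "distinct w \<Longrightarrow> star w = w"
  by (simp add: star_def)

lemma star_double: "star (z # z # zs) = z # zs"
  by (simp add: star_def)

lemma distinct_star: "w \<in> F_LLS X \<Longrightarrow> distinct (star w)"
  by (erule F_LLS_cases) (simp_all add: star_distinct star_double)

lemma set_star: "w \<in> F_LLS X \<Longrightarrow> set (star w) = set w"
  by (erule F_LLS_cases) (simp_all add: star_distinct star_double)

lemma star_eq_Cons: "w \<in> F_LLS X \<Longrightarrow> \<exists>s. star w = hd w # s"
  by (erule F_LLS_cases) (simp_all add: star_distinct star_double)

lemma F_LLS_nonempty: "w \<in> F_LLS X \<Longrightarrow> w \<noteq> []"
  by (simp add: F_LLS_def)

lemma F_LLS_subset: "w \<in> F_LLS X \<Longrightarrow> set w \<subseteq> X"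
  by (simp add: F_LLS_def)

text \<open>A word of \<open>F_LLS X\<close> that is not distinct is recovered from its
  \<open>star\<close> by doubling the first letter.\<close>

lemma F_LLS_eq_iff:
  assumes "v \<in> F_LLS X" "w \<in> F_LLS X"
  shows "v = w \<longleftrightarrow> star v = star w \<and> distinct v = distinct w"
  using assms
  by (elim F_LLS_cases) (auto simp: star_distinct star_double)

text \<open>As \<open>w\<close> is nonempty, the case condition of \<open>lls_mult\<close> becomes
  the plain equation \<open>v = [hd w]\<close>.\<close>

lemma lls_mult_eq:
  assumes "v \<in> F_LLS X" "w \<in> F_LLS X"
  shows "lls_mult v w =
    (if v = [hd w] then v @ v else v) @ filter (\<lambda>y. y \<notin> set v) (star w)"
  using F_LLS_nonempty[OF assms(2)]
  by (cases w) (auto simp: lls_mult_def remove_letters_def)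

lemma lls_mult_closed:
  assumes "v \<in> F_LLS X" "w \<in> F_LLS X"
  shows "lls_mult v w \<in> F_LLS X"
proof -
  have "distinct (star w)" "set (star w) \<subseteq> X"
    using assms distinct_star set_star F_LLS_subset by blast+
  from assms(1) this show ?thesis unfolding lls_mult_eq[OF assms]
    by (cases rule: F_LLS_cases) (auto intro!: Cons_in_F_LLS Cons_Cons_in_F_LLS)
qed

text \<open>In the doubling case \<open>star\<close> removes the extra letter again, so both cases
  of the product give one formula.\<close>

lemma star_lls_mult:
  assumes "v \<in> F_LLS X" "w \<in> F_LLS X"
  shows "star (lls_mult v w) = star v @ filter (\<lambda>y. y \<notin> set v) (star w)"
  using assms(1) distinct_star[OF assms(2)] unfolding lls_mult_eq[OF assms]
  by (cases rule: F_LLS_cases) (auto simp: star_def)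

lemma distinct_lls_mult:
  assumes "v \<in> F_LLS X" "w \<in> F_LLS X"
  shows "distinct (lls_mult v w) \<longleftrightarrow> distinct v \<and> v \<noteq> [hd w]"
  using distinct_star[OF assms(2)] unfolding lls_mult_eq[OF assms] by auto

lemma set_lls_mult:
  assumes "v \<in> F_LLS X" "w \<in> F_LLS X"
  shows "set (lls_mult v w) = set v \<union> set w"
  using set_star[OF assms(2)] unfolding lls_mult_eq[OF assms] by auto

lemma hd_lls_mult:
  assumes "v \<in> F_LLS X" "w \<in> F_LLS X"
  shows "hd (lls_mult v w) = hd v"
  using F_LLS_nonempty[OF assms(1)] unfolding lls_mult_eq[OF assms] by simp

text \<open>If \<open>v\<close> is a single letter, either it is doubled or \<open>hd w\<close>
  differs from it and survives the filter. So a product, used as a left factor, never triggers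
  doubling.\<close>

lemma lls_mult_neq_singleton:
  assumes "v \<in> F_LLS X" "w \<in> F_LLS X"
  shows "lls_mult v w \<noteq> [x]"
proof -
  obtain s where "star w = hd w # s" using star_eq_Cons[OF assms(2)] by blast
  with F_LLS_nonempty[OF assms(1)] show ?thesis unfolding lls_mult_eq[OF assms]
    by (cases v) (auto simp: Cons_eq_append_conv)
qed

section \<open>Associativity and left legality of the word product\<close>

lemma left_legal_semigroup_F_LLS:
  assumes "X \<noteq> {}"
  shows "left_legal_semigroup (F_LLS X) lls_mult"
proof
  from assms obtain x where "x \<in> X" by blast
  then show "F_LLS X \<noteq> {}" using Cons_in_F_LLS[of x "[]" X] by auto
next
  fix a b c assume F: "a \<in> F_LLS X" "b \<in> F_LLS X" "c \<in> F_LLS X"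
  have "star (lls_mult (lls_mult a b) c) = star (lls_mult a (lls_mult b c))"
    using F by (simp add: star_lls_mult[of _ X] lls_mult_closed set_lls_mult[of _ X] conj_commute)
  \<comment> \<open>Both sides reduce to \<open>distinct a \<and> a \<noteq> [hd b]\<close>.\<close>
  moreover have "distinct (lls_mult (lls_mult a b) c) = distinct (lls_mult a (lls_mult b c))"
    using F by (simp add: distinct_lls_mult[of _ X] lls_mult_closed hd_lls_mult[of _ X]
        lls_mult_neq_singleton[of _ X])
  ultimately show "lls_mult (lls_mult a b) c = lls_mult a (lls_mult b c)"
    using F_LLS_eq_iff[of _ X] F lls_mult_closed by metis
next
  fix a b assume F: "a \<in> F_LLS X" "b \<in> F_LLS X"
  then have "filter (\<lambda>y. y \<notin> set a \<union> set b) (star a) = []"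
    by (simp add: filter_empty_conv set_star)
  then show "lls_mult (lls_mult a b) a = lls_mult a b"
    using F by (simp add: lls_mult_eq[OF lls_mult_closed[OF F] F(1)] set_lls_mult[OF F]
        lls_mult_neq_singleton[OF F])
qed (fact lls_mult_closed)

section \<open>Generation by the one-letter words\<close>

lemma lls_mult_fresh: "y \<notin> set w \<Longrightarrow> lls_mult w [y] = w @ [y]"
  by (auto simp: lls_mult_def remove_letters_def star_def)

text \<open>Multiplying by a fresh letter on the right is concatenation, so the letters of
  \<open>v\<close> can be appended one at a time.\<close>

lemma generated_append:
  assumes "w \<in> generated lls_mult ((\<lambda>x. [x]) ` X)" "distinct v" "set v \<subseteq> X"
    "set v \<inter> set w = {}"
  shows "w @ v \<in> generated lls_mult ((\<lambda>x. [x]) ` X)"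
  using assms
proof (induction v arbitrary: w)
  case (Cons y v)
  have "[y] \<in> generated lls_mult ((\<lambda>x. [x]) ` X)"
    using Cons.prems by (intro generated.base) auto
  with Cons.prems have "w @ [y] \<in> generated lls_mult ((\<lambda>x. [x]) ` X)"
    using generated.mult lls_mult_fresh[of y w] by fastforce
  from Cons.IH[OF this] Cons.prems show ?case by auto
qed simp

lemma generated_F_LLS: "generated lls_mult ((\<lambda>x. [x]) ` X) = F_LLS X"
proof (intro set_eqI iffI)
  fix w assume "w \<in> generated lls_mult ((\<lambda>x. [x]) ` X)"
  then show "w \<in> F_LLS X"
    by induction (auto intro!: Cons_in_F_LLS lls_mult_closed)
next
  fix w assume "w \<in> F_LLS X"
  then show "w \<in> generated lls_mult ((\<lambda>x. [x]) ` X)"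
  proof (cases rule: F_LLS_cases)
    case (single z zs)
    then have "[z] \<in> generated lls_mult ((\<lambda>x. [x]) ` X)" by (intro generated.base) auto
    from generated_append[OF this, of zs] single show ?thesis by simp
  next
    case (double z zs)
    then have "[z] \<in> generated lls_mult ((\<lambda>x. [x]) ` X)" by (intro generated.base) auto
    \<comment> \<open>Squaring a letter is the doubling case and produces the repeated initial
      letter.\<close>
    from generated.mult[OF this this] have "[z, z] \<in> generated lls_mult ((\<lambda>x. [x]) ` X)"
      by (simp add: lls_mult_def remove_letters_def star_def)
    from generated_append[OF this, of zs] double show ?thesis by simp
  qed
qed

subsection \<open>Evaluation of words\<close>

context left_legal_semigroup
begin

text \<open>The left factor \<open>a\<close> matters: \<open>f b b = b\<close> fails in general,
  which is why words beginning with \<open>xx\<close> are kept.\<close>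

lemma mult_idem_right:
  assumes "a \<in> S" "b \<in> S"
  shows "f (f a b) b = f a b"
proof -
  have "f (f a b) b = f (f (f a b) a) b" using assms by (simp add: left_legal)
  also have "\<dots> = f a (f (f b a) b)" using assms by (simp add: assoc closed)
  also have "\<dots> = f (f a b) a" using assms by (simp add: left_legal flip: assoc)
  finally show ?thesis using assms by (simp add: left_legal)
qed

text \<open>\<open>pyc = pcyc = pcy = py\<close>: insert the absorbed \<open>c\<close>, apply left
  legality to \<open>c\<close> and \<open>y\<close>, and drop \<open>c\<close> again.\<close>

lemma absorb_mult:
  assumes "p \<in> S" "c \<in> S" "y \<in> S" "f p c = p"
  shows "f (f p y) c = f p y"
proof -
  have "f (f p y) c = f (f (f p c) y) c" using assms by simp
  also have "\<dots> = f p (f (f c y) c)" using assms(1-3) by (simp add: assoc closed)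
  also have "\<dots> = f (f p c) y" using assms(1-3) by (simp add: left_legal assoc)
  finally show ?thesis using assms by simp
qed

lemma foldl_closed: "p \<in> S \<Longrightarrow> set v \<subseteq> S \<Longrightarrow> foldl f p v \<in> S"
  by (induction v arbitrary: p) (auto simp: closed)

lemma foldl_mult: "p \<in> S \<Longrightarrow> q \<in> S \<Longrightarrow> set v \<subseteq> S \<Longrightarrow> foldl f (f p q) v = f p (foldl f q v)"
  by (induction v arbitrary: q) (auto simp: assoc closed)

lemma foldl_absorb:
  assumes "p \<in> S" "c \<in> S" "set v \<subseteq> S" "f p c = p"
  shows "f (foldl f p v) c = foldl f p v"
  using assms by (induction v arbitrary: p) (auto simp: absorb_mult closed)

text \<open>Just after the factor \<open>c\<close> the running product absorbs \<open>c\<close> by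
  \<open>mult_idem_right\<close>, thanks to the initial \<open>p\<close>; later factors preserve
  this.\<close>

lemma foldl_absorb_member:
  assumes "p \<in> S" "set v \<subseteq> S" "c \<in> set v"
  shows "f (foldl f p v) c = foldl f p v"
proof -
  obtain us vs where v: "v = us @ c # vs" using assms(3) by (meson split_list)
  have "foldl f p us \<in> S" using assms v by (intro foldl_closed) auto
  with assms show ?thesis unfolding v
    by (auto intro!: foldl_absorb simp: mult_idem_right closed)
qed

text \<open>Left legality makes \<open>p\<close> absorbed once one further factor has followed it;
  \<open>p\<close> alone need not absorb itself.\<close>

lemma foldl_absorb_first:
  assumes "p \<in> S" "set v \<subseteq> S" "v \<noteq> []"
  shows "f (foldl f p v) p = foldl f p v"
  using assms by (cases v) (auto intro!: foldl_absorb simp: left_legal closed)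

text \<open>Each deleted letter has a value that \<open>p\<close> absorbs, and by
  \<open>absorb_mult\<close> every later partial product still absorbs it.\<close>

lemma foldl_filter_absorb:
  assumes "p \<in> S" "\<phi> ` set v \<subseteq> S" "\<And>c. c \<in> set v \<Longrightarrow> \<not> P c \<Longrightarrow> f p (\<phi> c) = p"
  shows "foldl f p (map \<phi> (filter P v)) = foldl f p (map \<phi> v)"
  using assms
proof (induction v arbitrary: p)
  case (Cons a v)
  have a: "f p (\<phi> a) \<in> S" using Cons.prems by (auto intro: closed)
  have "f (f p (\<phi> a)) (\<phi> c) = f p (\<phi> a)" if "c \<in> set v" "\<not> P c" for c
    using that Cons.prems by (intro absorb_mult) auto
  with Cons.IH[OF a] Cons.prems(2)
  have "foldl f (f p (\<phi> a)) (map \<phi> (filter P v)) = foldl f (f p (\<phi> a)) (map \<phi> v)" by simp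
  with Cons.prems(3)[of a] show ?case by auto
qed simp

text \<open>The fold starts at the first letter because \<open>S\<close> need not have an identity;
  only nonempty words have a meaningful value.\<close>

definition word_eval :: "('c \<Rightarrow> 'a) \<Rightarrow> 'c list \<Rightarrow> 'a" where
  "word_eval \<phi> w = foldl f (\<phi> (hd w)) (map \<phi> (tl w))"

lemma word_eval_append:
  "v \<noteq> [] \<Longrightarrow> word_eval \<phi> (v @ w) = foldl f (word_eval \<phi> v) (map \<phi> w)"
  by (simp add: word_eval_def)

lemma word_eval_closed: "w \<noteq> [] \<Longrightarrow> \<phi> ` set w \<subseteq> S \<Longrightarrow> word_eval \<phi> w \<in> S"
  unfolding word_eval_def by (cases w) (auto intro!: foldl_closed)

lemma mult_word_eval:
  "p \<in> S \<Longrightarrow> w \<noteq> [] \<Longrightarrow> \<phi> ` set w \<subseteq> S \<Longrightarrow> f p (word_eval \<phi> w) = foldl f p (map \<phi> w)"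
  unfolding word_eval_def by (cases w) (auto simp: foldl_mult)

text \<open>The first letter is absorbed by left legality, any other by
  \<open>mult_idem_right\<close>; both need at least two factors.\<close>

lemma word_eval_absorb:
  assumes "\<phi> ` set w \<subseteq> S" "tl w \<noteq> []" "c \<in> set w"
  shows "f (word_eval \<phi> w) (\<phi> c) = word_eval \<phi> w"
proof (cases w)
  case (Cons x v)
  with assms have x: "\<phi> x \<in> S" and v: "set (map \<phi> v) \<subseteq> S" "map \<phi> v \<noteq> []" by auto
  have "f (foldl f (\<phi> x) (map \<phi> v)) (\<phi> c) = foldl f (\<phi> x) (map \<phi> v)"
  proof (cases "c = x")
    case True
    then show ?thesis using foldl_absorb_first[OF x v] by simp
  next
    case False
    then show ?thesis using assms(3) Cons foldl_absorb_member[OF x v(1), of "\<phi> c"] by auto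
  qed
  then show ?thesis by (simp add: word_eval_def Cons)
qed (use assms in simp)

text \<open>Behind a factor \<open>p\<close>, an initial \<open>zz\<close> acts like
  \<open>z\<close>.\<close>

lemma foldl_star:
  assumes "w \<in> F_LLS X" "p \<in> S" "\<phi> ` X \<subseteq> S"
  shows "foldl f p (map \<phi> (star w)) = foldl f p (map \<phi> w)"
  using assms
  by (cases rule: F_LLS_cases) (auto simp: star_distinct star_double mult_idem_right)

lemma word_eval_lls_mult:
  assumes v: "v \<in> F_LLS X" and w: "w \<in> F_LLS X" and \<phi>: "\<phi> ` X \<subseteq> S"
  shows "word_eval \<phi> (lls_mult v w) = f (word_eval \<phi> v) (word_eval \<phi> w)"
proof -
  have ne: "v \<noteq> []" "w \<noteq> []" using v w by (simp_all add: F_LLS_nonempty)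
  have sub: "\<phi> ` set v \<subseteq> S" "\<phi> ` set w \<subseteq> S" using v w \<phi> F_LLS_subset by blast+
  have pS: "word_eval \<phi> v \<in> S" using ne(1) sub(1) by (rule word_eval_closed)
  obtain s where s: "star w = hd w # s" using star_eq_Cons[OF w] by blast
  have s_sub: "\<phi> ` set (hd w # s) \<subseteq> S" using sub(2) set_star[OF w] s by simp
  have mult: "f (word_eval \<phi> v) (word_eval \<phi> w) = foldl f (word_eval \<phi> v) (map \<phi> (hd w # s))"
    using mult_word_eval[OF pS ne(2) sub(2)] foldl_star[OF w pS \<phi>] s by simp
  show ?thesis
  proof (cases "tl v = []")
    case False
    then have "v \<noteq> [hd w]" by auto
    then have "word_eval \<phi> (lls_mult v w) =
        foldl f (word_eval \<phi> v) (map \<phi> (filter (\<lambda>y. y \<notin> set v) (hd w # s)))"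
      using lls_mult_eq[OF v w] s ne(1) by (simp add: word_eval_append \<open>v \<noteq> [hd w]\<close>)
    \<comment> \<open>With at least two letters, the value of \<open>v\<close> absorbs all its
      letters, so the filter has no effect.\<close>
    also have "\<dots> = foldl f (word_eval \<phi> v) (map \<phi> (hd w # s))"
      using pS s_sub word_eval_absorb[OF sub(1) False] by (intro foldl_filter_absorb) auto
    finally show ?thesis by (simp only: mult)
  next
    case True
    with ne(1) obtain x where x: "v = [x]" by (cases v) auto
    \<comment> \<open>The value of \<open>[x]\<close> need not absorb \<open>\<phi> x\<close>, so
      the first letter of \<open>w\<close> is joined to \<open>x\<close> to obtain two
      factors.\<close>
    let ?q = "word_eval \<phi> [x, hd w]"
    have q_sub: "\<phi> ` set [x, hd w] \<subseteq> S" using sub x s_sub by auto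
    have qS: "?q \<in> S" using q_sub by (intro word_eval_closed) auto
    \<comment> \<open>If \<open>hd w = x\<close>, doubling supplies the second letter and the filter
      drops \<open>hd w\<close>; otherwise \<open>hd w\<close> survives the filter.\<close>
    have "lls_mult v w = [x, hd w] @ filter (\<lambda>y. y \<noteq> x) s"
      using lls_mult_eq[OF v w] s x by simp
    then have "word_eval \<phi> (lls_mult v w) = foldl f ?q (map \<phi> (filter (\<lambda>y. y \<noteq> x) s))"
      by (simp only: word_eval_append list.distinct not_False_eq_True)
    also have "\<dots> = foldl f ?q (map \<phi> s)"
      using qS s_sub word_eval_absorb[OF q_sub] by (intro foldl_filter_absorb) auto
    also have "\<dots> = foldl f (word_eval \<phi> v) (map \<phi> (hd w # s))"
      by (simp add: x word_eval_def)
    finally show ?thesis by (simp only: mult)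
  qed
qed

lemma word_eval_hom:
  assumes "\<phi> ` X \<subseteq> S"
  shows "semigroup_hom (F_LLS X) lls_mult S f (word_eval \<phi>)"
proof -
  have "word_eval \<phi> w \<in> S" if "w \<in> F_LLS X" for w
    using that assms F_LLS_nonempty F_LLS_subset by (intro word_eval_closed) blast+
  with assms show ?thesis by (simp add: semigroup_hom_def word_eval_lls_mult)
qed

end

theorem theorem3:
  fixes X :: "'a set"
  assumes "X \<noteq> {}"
  shows "left_legal_semigroup (F_LLS X) lls_mult \<and>
    generated lls_mult ((\<lambda>x. [x]) ` X) = F_LLS X \<and>
    (\<forall>(A :: 'b set) g \<phi>. left_legal_semigroup A g \<longrightarrow> (\<forall>x\<in>X. \<phi> x \<in> A) \<longrightarrow>
       (\<exists>h. semigroup_hom (F_LLS X) lls_mult A g h \<and> (\<forall>x\<in>X. h [x] = \<phi> x)))"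
proof (intro conjI allI impI)
  show "left_legal_semigroup (F_LLS X) lls_mult"
    using assms by (rule left_legal_semigroup_F_LLS)
  show "generated lls_mult ((\<lambda>x. [x]) ` X) = F_LLS X"
    by (rule generated_F_LLS)
next
  fix A :: "'b set" and g \<phi>
  assume "left_legal_semigroup A g" and \<phi>: "\<forall>x\<in>X. \<phi> x \<in> A"
  then interpret left_legal_semigroup A g by simp
  have "semigroup_hom (F_LLS X) lls_mult A g (word_eval \<phi>)"
    using \<phi> by (intro word_eval_hom) auto
  moreover have "\<forall>x\<in>X. word_eval \<phi> [x] = \<phi> x" by (simp add: word_eval_def)
  ultimately show "\<exists>h. semigroup_hom (F_LLS X) lls_mult A g h \<and> (\<forall>x\<in>X. h [x] = \<phi> x)"
    by blast
qed

end
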